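(* Let $S=\mathbb F_2[x]/(x^{512}+1)$. An element of $S$ is a unit if and only if its weight (the number of nonzero coefficients of its representative of degree less than $512$) is odd. Consequently, for two challenges $\delta,\delta'\in\mathcal C$, the difference $\delta-\delta'$ reduced modulo $2$ is a unit of $S$ if and only if the Hamming distance between the coefficient vectors of $\delta$ and $\delta'$ is odd. The fraction of pairs of distinct challenges whose difference is a nonunit of $S$ is $$\frac{2^{255}-1}{2^{256}-1}=\frac12-\frac1{2^{257}-2},$$ and if $\delta,\delta'$ are drawn independently and uniformly from $\mathcal C$, then $\delta-\delta'$ is a nonunit of $S$ with probability $\tfrac12$.
   Context: The challenge set $\mathcal C$ is the set of all polynomials of degree less than $256$ with coefficients in $\{0,1\}$, so $|\mathcal C|=2^{256}$; it is regarded inside $\mathbb Z[x]/(x^{512}+1)$, and differences are reduced modulo $2$ into $S$. *)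

theory Defs
  imports
    "HOL-Algebra.Algebraic_Closure_Type"
    "HOL-Algebra.QuotRing"
    "HOL-Computational_Algebra.Polynomial"
    "HOL-Library.Z2"
    "HOL-Probability.Probability"
begin

(* The quotient A[x]/(x^512 + 1) is the HOL-Algebra quotient of the polynomial ring over the
   coefficient type A; its elements are the cosets of the principal ideal (x^512 + 1).
   Coefficients of type bit give F_2. *)

definition modulus_ideal :: "'a::comm_ring_1 poly set" where
  "modulus_ideal = PIdl\<^bsub>ring_of_type_algebra\<^esub> (Polynomial.monom 1 512 + 1)"

definition quotient512 :: "'a::comm_ring_1 poly set ring" where
  "quotient512 = ring_of_type_algebra Quot modulus_ideal"

definition residue :: "'a::comm_ring_1 poly \<Rightarrow> 'a poly set" where
  "residue p = modulus_ideal +>\<^bsub>ring_of_type_algebra\<^esub> p"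

abbreviation RZ :: "int poly set ring" where
  "RZ \<equiv> quotient512"

abbreviation S :: "bit poly set ring" where
  "S \<equiv> quotient512"

definition representative :: "'a::comm_ring_1 poly set \<Rightarrow> 'a poly" where
  "representative s = (THE p. p \<in> s \<and> Polynomial.degree p < 512)"

definition weight :: "bit poly set \<Rightarrow> nat" where
  "weight s = card {i. Polynomial.coeff (representative s) i \<noteq> 0}"

(* The map Z[x]/(x^512 + 1) -> S induced by coefficientwise reduction modulo 2.  The image taken
   here is a singleton, see reduce_mod2_residue below. *)
definition reduce_mod2 :: "int poly set \<Rightarrow> bit poly set" where
  "reduce_mod2 a = the_elem ((\<lambda>p. residue (map_poly of_int p)) ` a)"

definition challenges :: "int poly set" where
  "challenges = {p. Polynomial.degree p < 256 \<and> (\<forall>i. Polynomial.coeff p i \<in> {0, 1})}"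

definition challenge_diff :: "int poly \<Rightarrow> int poly \<Rightarrow> bit poly set" where
  "challenge_diff \<delta> \<delta>' = reduce_mod2 (residue \<delta> \<ominus>\<^bsub>RZ\<^esub> residue \<delta>')"

definition hamming_distance :: "int poly \<Rightarrow> int poly \<Rightarrow> nat" where
  "hamming_distance \<delta> \<delta>' = card {i. i < 256 \<and> Polynomial.coeff \<delta> i \<noteq> Polynomial.coeff \<delta>' i}"

lemma modulus_ideal_eq: "modulus_ideal = {q. (Polynomial.monom 1 512 + 1) dvd q}"
  by (auto simp: modulus_ideal_def cgenideal_def ring_of_type_algebra_def dvd_def mult.commute)

lemma ideal_modulus_ideal: "ideal modulus_ideal ring_of_type_algebra"
  unfolding modulus_ideal_def
  by (rule cring.cgenideal_ideal[OF cring_from_type_algebra])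
     (simp add: ring_of_type_algebra_def)

lemma cring_quotient512: "cring quotient512"
  unfolding quotient512_def
  by (rule ideal.quotient_is_cring[OF ideal_modulus_ideal cring_from_type_algebra])

lemma residue_eq: "residue p = {q. (Polynomial.monom 1 512 + 1) dvd (q - p)}"
proof -
  have "residue p = {h + p | h. h \<in> modulus_ideal}"
    by (auto simp: residue_def a_r_coset_def' ring_of_type_algebra_def)
  also have "\<dots> = {q. (Polynomial.monom 1 512 + 1) dvd (q - p)}"
    unfolding modulus_ideal_eq by (auto intro: exI[of _ "_ - p"])
  finally show ?thesis .
qed

lemma carrier_quotient512: "carrier quotient512 = range residue"
  by (auto simp: quotient512_def FactRing_def A_RCOSETS_def' residue_def
      ring_of_type_algebra_def)

lemma residue_diff:
  fixes p q :: "'a::comm_ring_1 poly"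
  shows "residue p \<ominus>\<^bsub>quotient512\<^esub> residue q = residue (p - q)"
proof -
  interpret Q: cring "quotient512 :: 'a poly set ring" by (rule cring_quotient512)
  have add: "residue a \<oplus>\<^bsub>quotient512\<^esub> residue b = residue (a + b)" for a b :: "'a poly"
    using ring_hom_add[OF ideal.rcos_ring_hom[OF ideal_modulus_ideal], of a b]
    by (simp add: quotient512_def residue_def ring_of_type_algebra_def)
  have "residue p = residue (p - q) \<oplus>\<^bsub>quotient512\<^esub> residue q"
    by (simp add: add)
  then show ?thesis
    by (metis Q.add.inv_solve_right' carrier_quotient512 rangeI a_minus_def)
qed

lemma reduce_mod2_residue: "reduce_mod2 (residue p) = residue (map_poly of_int p)"
proof -
  let ?r = "\<lambda>p. map_poly of_int p :: bit poly"
  have diff: "?r (a - b) = ?r a - ?r b" for a b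
    by (intro poly_eqI) (simp add: coeff_map_poly)
  have mult: "?r (a * b) = ?r a * ?r b" for a b
    by (intro poly_eqI) (simp add: coeff_map_poly coeff_mult)
  have m: "?r (Polynomial.monom 1 512 + 1) = Polynomial.monom 1 512 + 1"
    by (intro poly_eqI) (simp add: coeff_map_poly coeff_1)
  have "residue (?r q) = residue (?r p)" if "q \<in> residue p" for q
  proof -
    obtain h where "q - p = (Polynomial.monom 1 512 + 1) * h"
      using \<open>q \<in> residue p\<close> unfolding residue_eq dvd_def by blast
    then have d: "(Polynomial.monom 1 512 + 1) dvd (?r q - ?r p)"
      by (metis diff mult m dvd_triv_left)
    show ?thesis
    proof (unfold residue_eq, intro Collect_cong)
      fix t :: "bit poly"
      have "t - ?r p = (t - ?r q) + (?r q - ?r p)" by simp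
      then show "(Polynomial.monom 1 512 + 1) dvd (t - ?r q) \<longleftrightarrow>
          (Polynomial.monom 1 512 + 1) dvd (t - ?r p)"
        using dvd_add_left_iff[OF d] by metis
    qed
  qed
  moreover have "p \<in> residue p" by (simp add: residue_eq)
  ultimately have "(\<lambda>q. residue (?r q)) ` residue p = {residue (?r p)}" by blast
  then show ?thesis by (simp add: reduce_mod2_def)
qed

lemma challenge_diff_eq: "challenge_diff \<delta> \<delta>' = residue (map_poly of_int (\<delta> - \<delta>'))"
  by (simp add: challenge_diff_def residue_diff reduce_mod2_residue)

lemma representative_residue:
  fixes p :: "'a::field poly"
  assumes "Polynomial.degree p < 512"
  shows "representative (residue p) = p"
  unfolding representative_def
proof (rule the_equality)
  show "p \<in> residue p \<and> Polynomial.degree p < 512"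
    using assms by (simp add: residue_eq)
next
  fix q :: "'a poly" assume q: "q \<in> residue p \<and> Polynomial.degree q < 512"
  let ?m = "Polynomial.monom 1 512 + 1 :: 'a poly"
  have "Polynomial.coeff ?m 512 = 1" by (simp add: coeff_1)
  then have "512 \<le> Polynomial.degree ?m" by (intro le_degree) simp
  moreover have "Polynomial.degree (q - p) < 512"
    using assms q by (intro degree_diff_less) auto
  moreover have "?m dvd q - p" using q by (simp add: residue_eq)
  ultimately have "q - p = 0" using dvd_imp_degree_le[of ?m "q - p"] by linarith
  then show "q = p" by simp
qed

end

theory Submission
  imports Defs
begin

text \<open>
  In characteristic 2 the modulus is \<open>x^512 + 1 = (x + 1)^512\<close>, so \<open>S\<close> is a local ring whose
  maximal ideal is the kernel of evaluation at 1. If \<open>p(1) = 1\<close>, then \<open>x + 1\<close> divides \<open>p + 1\<close>,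
  hence \<open>p^512 + 1 = (p + 1)^512\<close> vanishes in \<open>S\<close> and \<open>p^511\<close> is inverse to \<open>p\<close>. Evaluation at 1 is
  the parity of the weight. The difference of two challenges is therefore a nonunit exactly if
  their weights have the same parity; flipping the constant coefficient shows that both parity
  classes have \<open>2^255\<close> elements.
\<close>

section \<open>Arithmetic of residue classes modulo \<open>x^512 + 1\<close>\<close>

lemma residue_eq_iff:
  fixes p q :: "'a::comm_ring_1 poly"
  shows "residue p = residue q \<longleftrightarrow> (Polynomial.monom 1 512 + 1) dvd p - q"
proof
  assume "residue p = residue q"
  moreover have "p \<in> residue p" by (simp add: residue_eq)
  ultimately have "p \<in> residue q" by simp
  then show "(Polynomial.monom 1 512 + 1) dvd p - q" by (simp add: residue_eq)
next
  assume d: "(Polynomial.monom 1 512 + 1) dvd p - q"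
  have "(Polynomial.monom 1 512 + 1) dvd t - p \<longleftrightarrow> (Polynomial.monom 1 512 + 1) dvd t - q" for t
    using dvd_add_left_iff[OF d, of "t - p"] by simp
  then show "residue p = residue q" by (simp add: residue_eq)
qed

lemma mult_residue: "residue p \<otimes>\<^bsub>quotient512\<^esub> residue q = residue (p * q)"
  using ring_hom_mult[OF ideal.rcos_ring_hom[OF ideal_modulus_ideal], of p q]
  by (simp add: quotient512_def residue_def ring_of_type_algebra_def)

lemma one_quotient512: "\<one>\<^bsub>quotient512\<^esub> = residue 1"
  using ring_hom_one[OF ideal.rcos_ring_hom[OF ideal_modulus_ideal], symmetric]
  by (simp add: quotient512_def residue_def ring_of_type_algebra_def)

text \<open>Every class has the form \<open>residue q\<close> and the quotient is commutative, so
  invertibility becomes a divisibility question about polynomials.\<close>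

lemma residue_Units_iff:
  fixes p :: "'a::comm_ring_1 poly"
  shows "residue p \<in> Units quotient512 \<longleftrightarrow> (\<exists>q. (Polynomial.monom 1 512 + 1) dvd p * q - 1)"
proof -
  have "residue p \<in> Units quotient512 \<longleftrightarrow> (\<exists>q. residue (p * q) = residue (1 :: 'a poly))"
    by (auto simp: Units_def carrier_quotient512 mult_residue one_quotient512 mult.commute)
  then show ?thesis by (simp add: residue_eq_iff)
qed

section \<open>Units of \<open>S\<close> and evaluation at 1\<close>

lemma bit_poly_two_eq_0: "(2 :: bit poly) = 0"
  by (metis bit_numeral_even numeral_poly pCons_0_0)

text \<open>The iterated Frobenius map: each squaring loses its cross term because 2 = 0. It is used
  with \<open>k = 9\<close>, as 512 = 2^9.\<close>

lemma bit_poly_power_2_power: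
  fixes p q :: "bit poly"
  shows "(p + q) ^ 2 ^ k = p ^ 2 ^ k + q ^ 2 ^ k"
proof (induction k)
  case (Suc k)
  have "(p + q) ^ 2 ^ Suc k = (p ^ 2 ^ k + q ^ 2 ^ k) ^ 2"
    by (simp add: power_mult mult.commute[of 2] Suc.IH)
  also have "\<dots> = p ^ 2 ^ Suc k + q ^ 2 ^ Suc k"
    by (simp add: power2_sum bit_poly_two_eq_0 power_mult mult.commute[of 2])
  finally show ?case .
qed simp

lemma bit_modulus_eq_power: "Polynomial.monom 1 512 + 1 = ([:1, 1:] :: bit poly) ^ 512"
proof -
  have "([:1, 1:] :: bit poly) = Polynomial.monom 1 1 + 1"
    by (simp add: monom_altdef one_pCons)
  then have "([:1, 1:] :: bit poly) ^ 2 ^ 9 = Polynomial.monom 1 1 ^ 2 ^ 9 + 1 ^ 2 ^ 9"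
    using bit_poly_power_2_power[of "Polynomial.monom 1 1" 1 9] by simp
  then show ?thesis by (simp add: monom_power)
qed

lemma residue_Units_iff_poly_1: "residue p \<in> Units S \<longleftrightarrow> poly p 1 = 1"
proof
  assume "residue p \<in> Units S"
  then obtain q where "(Polynomial.monom 1 512 + 1) dvd p * q - 1"
    unfolding residue_Units_iff by blast
  then obtain h where "p * q - 1 = (Polynomial.monom 1 512 + 1) * h" by blast
  then have "poly (p * q - 1) 1 = poly ((Polynomial.monom 1 512 + 1) * h) 1" by simp
  \<comment> \<open>The modulus takes the value 1 + 1 = 0 at 1, so the right-hand side
    vanishes.\<close>
  then have "poly p 1 * poly q 1 = 1" by (simp add: poly_monom)
  then show "poly p 1 = 1" by simp
next
  assume "poly p 1 = 1"
  \<comment> \<open>Over F_2 the linear factor belonging to the root 1 is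
    \<open>x - 1 = x + 1\<close>.\<close>
  then have "[:1, 1:] dvd p + 1"
    using poly_eq_0_iff_dvd[of "p + 1" 1] by simp
  then have "[:1, 1:] ^ 512 dvd (p + 1) ^ 512" by (rule dvd_power_same)
  also have "(p + 1) ^ 512 = p ^ 512 + 1"
    using bit_poly_power_2_power[of p 1 9] by simp
  \<comment> \<open>Splitting off one factor \<open>p\<close> exhibits \<open>p ^ 511\<close> as the
    inverse; the sign of 1 is then free in characteristic 2.\<close>
  also have "\<dots> = p * p ^ (512 - 1) + 1"
    by (simp only: power_minus_mult mult.commute[of p] zero_less_numeral)
  also have "\<dots> = p * p ^ (512 - 1) - 1"
    unfolding eq_diff_eq add.assoc one_add_one bit_poly_two_eq_0 by (rule add_0_right)
  finally show "residue p \<in> Units S"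
    unfolding residue_Units_iff bit_modulus_eq_power by blast
qed

section \<open>Evaluation at 1 as parity of the weight\<close>

lemma sum_bit_eq_1_iff:
  fixes f :: "'a \<Rightarrow> bit"
  assumes "finite A"
  shows "sum f A = 1 \<longleftrightarrow> odd (card {x \<in> A. f x \<noteq> 0})"
  using assms
proof (induction A rule: finite_induct)
  case (insert x A)
  have "{y \<in> insert x A. f y \<noteq> 0} =
      (if f x = 0 then {y \<in> A. f y \<noteq> 0} else insert x {y \<in> A. f y \<noteq> 0})" by auto
  with insert show ?case by (cases "f x"; cases "sum f A") auto
qed simp

lemma poly_1_bit_eq_1_iff:
  fixes p :: "bit poly"
  shows "poly p 1 = 1 \<longleftrightarrow> odd (card {i. Polynomial.coeff p i \<noteq> 0})"
proof -
  \<comment> \<open>The value at 1 is the sum of the coefficients up to the degree, and no nonzero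
    coefficient lies beyond it.\<close>
  have "{i \<in> {..Polynomial.degree p}. Polynomial.coeff p i \<noteq> 0} = {i. Polynomial.coeff p i \<noteq> 0}"
    by (auto simp: le_degree)
  then show ?thesis
    using sum_bit_eq_1_iff[of "{..Polynomial.degree p}" "Polynomial.coeff p"]
    by (simp only: poly_altdef power_one mult_1_right finite_atMost)
qed

lemma degree_modulus: "Polynomial.degree (Polynomial.monom 1 512 + 1 :: 'a::comm_ring_1 poly) = 512"
  by (subst degree_add_eq_left) (simp_all add: degree_monom_eq)

text \<open>Division with remainder by the modulus supplies the low-degree polynomial, to which
  \<open>representative_residue\<close> applies.\<close>

lemma carrier_quotient512_cases:
  fixes s :: "'a::field poly set"
  assumes "s \<in> carrier quotient512"
  obtains p where "s = residue p" "Polynomial.degree p < 512"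
proof -
  let ?m = "Polynomial.monom 1 512 + 1 :: 'a poly"
  obtain q where q: "s = residue q" using assms by (auto simp: carrier_quotient512)
  have "?m dvd q - q mod ?m" by (simp add: minus_mod_eq_mult_div)
  then have "s = residue (q mod ?m)" by (simp add: q residue_eq_iff)
  moreover have "?m \<noteq> 0" using degree_modulus[where 'a = 'a] by auto
  then have "Polynomial.degree (q mod ?m) < 512"
    using degree_mod_less[of ?m q] degree_modulus[where 'a = 'a] by auto
  ultimately show thesis by (rule that)
qed

lemma Units_iff_odd_weight:
  assumes "s \<in> carrier S"
  shows "s \<in> Units S \<longleftrightarrow> odd (weight s)"
  using assms
  by (elim carrier_quotient512_cases)
    (simp add: weight_def representative_residue residue_Units_iff_poly_1 poly_1_bit_eq_1_iff)

section \<open>Differences of challenges\<close>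

lemma of_int_bit_eq_0_iff: "(of_int n :: bit) = 0 \<longleftrightarrow> even n"
proof (cases "even n")
  case False
  then obtain k where "n = 2 * k + 1" by (auto elim: oddE)
  then show ?thesis by simp
qed (auto elim: evenE)

lemma challenge_diff_Units_iff_hamming:
  assumes "\<delta> \<in> challenges" "\<delta>' \<in> challenges"
  shows "challenge_diff \<delta> \<delta>' \<in> Units S \<longleftrightarrow> odd (hamming_distance \<delta> \<delta>')"
proof -
  \<comment> \<open>A difference of two elements of {0, 1} is odd exactly if they differ; from index
    256 on both coefficients are 0.\<close>
  have "(of_int (Polynomial.coeff \<delta> i - Polynomial.coeff \<delta>' i) :: bit) \<noteq> 0 \<longleftrightarrow>
      i < 256 \<and> Polynomial.coeff \<delta> i \<noteq> Polynomial.coeff \<delta>' i" for i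
  proof -
    have "Polynomial.coeff \<delta> i \<in> {0, 1}" "Polynomial.coeff \<delta>' i \<in> {0, 1}"
      "i \<ge> 256 \<Longrightarrow> Polynomial.coeff \<delta> i = 0" "i \<ge> 256 \<Longrightarrow> Polynomial.coeff \<delta>' i = 0"
      using assms by (auto simp: challenges_def coeff_eq_0)
    then show ?thesis unfolding of_int_bit_eq_0_iff by (cases "i < 256") auto
  qed
  then show ?thesis
    by (simp only: challenge_diff_eq residue_Units_iff_poly_1 poly_1_bit_eq_1_iff
        hamming_distance_def coeff_map_poly of_int_0 coeff_diff)
qed

lemma poly_map_poly_of_int_1:
  "poly (map_poly of_int p :: 'a::comm_ring_1 poly) 1 = of_int (poly p 1)"
proof (induction p)
  case (pCons a p)
  then show ?case by (simp add: map_poly_pCons)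
qed simp

text \<open>This criterion is meant for counting: it depends on each polynomial only through the
  parity of its value at 1, so the nonunit pairs split into two product sets.\<close>

lemma challenge_diff_Units_iff_parity:
  "challenge_diff \<delta> \<delta>' \<in> Units S \<longleftrightarrow> odd (poly \<delta> 1 - poly \<delta>' 1)"
proof -
  have "challenge_diff \<delta> \<delta>' \<in> Units S \<longleftrightarrow> (of_int (poly (\<delta> - \<delta>') 1) :: bit) = 1"
    by (simp only: challenge_diff_eq residue_Units_iff_poly_1 poly_map_poly_of_int_1)
  also have "\<dots> \<longleftrightarrow> odd (poly \<delta> 1 - poly \<delta>' 1)"
    by (simp only: bit_not_zero_iff[symmetric] of_int_bit_eq_0_iff poly_diff)
  finally show ?thesis .
qed

section \<open>Counting challenges and their parity classes\<close>

lemma bij_betw_support_challenges: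
  "bij_betw (\<lambda>p. {i. Polynomial.coeff p i = 1}) challenges (Pow {..<256})"
proof (rule bij_betwI)
  let ?g = "\<lambda>A. \<Sum>i\<in>A. Polynomial.monom 1 i :: int poly"
  \<comment> \<open>The bound on \<open>A\<close> provides finiteness; a sum over an infinite set
    would be 0 by default.\<close>
  have coeff: "Polynomial.coeff (?g A) i = of_bool (i \<in> A)" if "A \<subseteq> {..<256}" for A i
    using finite_subset[OF that] by (simp add: coeff_sum)
  have support: "{i. Polynomial.coeff p i = 1} \<subseteq> {..<256}" if "p \<in> challenges" for p
  proof
    fix i assume "i \<in> {i. Polynomial.coeff p i = 1}"
    then have "i \<le> Polynomial.degree p" by (intro le_degree) simp
    with that show "i \<in> {..<256}" by (simp add: challenges_def)
  qed
  then show "(\<lambda>p. {i. Polynomial.coeff p i = 1}) \<in> challenges \<rightarrow> Pow {..<256}" by blast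
  show "?g \<in> Pow {..<256} \<rightarrow> challenges"
  proof (intro Pi_I)
    fix A :: "nat set"
    assume "A \<in> Pow {..<256}"
    then have A: "A \<subseteq> {..<256}" by simp
    have "Polynomial.degree (?g A) \<le> 255"
      using A by (intro degree_le) (auto simp: coeff[OF A])
    then show "?g A \<in> challenges"
      unfolding challenges_def by (simp add: coeff[OF A])
  qed
  show "?g {i. Polynomial.coeff p i = 1} = p" if "p \<in> challenges" for p
    using that by (intro poly_eqI) (auto simp: coeff[OF support[OF that]] challenges_def)
  show "{i. Polynomial.coeff (?g A) i = 1} = A" if "A \<in> Pow {..<256}" for A
    using that by (simp add: coeff)
qed

lemma card_challenges: "card challenges = 2 ^ 256"
  using bij_betw_same_card[OF bij_betw_support_challenges] by (simp add: card_Pow)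

lemma finite_challenges: "finite challenges"
  \<comment> \<open>Infinite sets have cardinality 0 by convention, so a positive cardinality forces
    finiteness.\<close>
  by (rule card_ge_0_finite) (simp add: card_challenges)

lemma card_challenges_even_eq_odd:
  "card {\<delta> \<in> challenges. even (poly \<delta> 1)} = card {\<delta> \<in> challenges. odd (poly \<delta> 1)}"
proof -
  \<comment> \<open>Adding \<open>1 - 2 * c\<close> to the constant coefficient \<open>c\<close>
    turns it into \<open>1 - c\<close>: this swaps 0 and 1 and changes the value at 1 by an odd
    number.\<close>
  define flip :: "int poly \<Rightarrow> int poly" where
    "flip p = p + [:1 - 2 * Polynomial.coeff p 0:]" for p
  have flip: "flip p \<in> challenges" if "p \<in> challenges" for p
    using that unfolding flip_def challenges_def
    by (auto intro!: degree_add_less simp: coeff_pCons split: nat.split)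
  have parity: "even (poly (flip p) 1) \<longleftrightarrow> odd (poly p 1)" for p
    by (simp add: flip_def)
  have involution: "flip (flip p) = p" for p
    by (simp add: flip_def)
  have "bij_betw flip {\<delta> \<in> challenges. even (poly \<delta> 1)} {\<delta> \<in> challenges. odd (poly \<delta> 1)}"
    by (rule bij_betwI[where g = flip]) (auto simp: flip parity involution)
  then show ?thesis by (rule bij_betw_same_card)
qed

lemma card_challenges_parity:
  "card {\<delta> \<in> challenges. even (poly \<delta> 1)} = 2 ^ 255"
  "card {\<delta> \<in> challenges. odd (poly \<delta> 1)} = 2 ^ 255"
proof -
  let ?E = "{\<delta> \<in> challenges. even (poly \<delta> 1)}" and ?O = "{\<delta> \<in> challenges. odd (poly \<delta> 1)}"
  have "card challenges = card (?E \<union> ?O)" by (rule arg_cong[of _ _ card]) auto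
  also have "\<dots> = card ?E + card ?O"
    using finite_challenges by (intro card_Un_disjoint) auto
  finally show "card ?E = 2 ^ 255" "card ?O = 2 ^ 255"
    using card_challenges card_challenges_even_eq_odd by simp_all
qed

section \<open>Counting pairs and the uniform distribution\<close>

lemma card_nonunit_pairs:
  "card {(\<delta>, \<delta>'). \<delta> \<in> challenges \<and> \<delta>' \<in> challenges \<and> challenge_diff \<delta> \<delta>' \<notin> Units S} = 2 ^ 511"
proof -
  let ?E = "{\<delta> \<in> challenges. even (poly \<delta> 1)}" and ?O = "{\<delta> \<in> challenges. odd (poly \<delta> 1)}"
  \<comment> \<open>A nonunit difference means equal parities, which gives 2 * 2^255 * 2^255 = 2^511
    pairs.\<close>
  have "{(\<delta>, \<delta>'). \<delta> \<in> challenges \<and> \<delta>' \<in> challenges \<and> challenge_diff \<delta> \<delta>' \<notin> Units S} =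
      ?E \<times> ?E \<union> ?O \<times> ?O"
    by (auto simp: challenge_diff_Units_iff_parity)
  moreover have "card (?E \<times> ?E \<union> ?O \<times> ?O) = card (?E \<times> ?E) + card (?O \<times> ?O)"
    using finite_challenges by (intro card_Un_disjoint) auto
  ultimately show ?thesis by (simp add: card_cartesian_product card_challenges_parity)
qed

text \<open>Reflexivity of \<open>P\<close> on \<open>A\<close> puts the whole diagonal among the
  pairs counted, so removing it costs exactly \<open>card A\<close>. It serves for the nonunit pairs
  and, with \<open>P\<close> always true, for all pairs.\<close>

lemma card_distinct_pairs:
  assumes "finite A" "\<And>x. x \<in> A \<Longrightarrow> P x x"
  shows "card {(x, y). x \<in> A \<and> y \<in> A \<and> x \<noteq> y \<and> P x y} =
    card {(x, y). x \<in> A \<and> y \<in> A \<and> P x y} - card A"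
proof -
  have "{(x, y). x \<in> A \<and> y \<in> A \<and> x \<noteq> y \<and> P x y} =
      {(x, y). x \<in> A \<and> y \<in> A \<and> P x y} - (\<lambda>x. (x, x)) ` A" by auto
  moreover have "(\<lambda>x. (x, x)) ` A \<subseteq> {(x, y). x \<in> A \<and> y \<in> A \<and> P x y}"
    using assms(2) by auto
  moreover have "card ((\<lambda>x. (x, x)) ` A) = card A" by (simp add: card_image inj_on_def)
  ultimately show ?thesis using assms(1) by (simp add: card_Diff_subset)
qed

text \<open>Independent uniform draws are one uniform draw from the product, which reduces the
  probability to a count.\<close>

lemma pair_pmf_of_set:
  assumes "finite A" "A \<noteq> {}" "finite B" "B \<noteq> {}"
  shows "pair_pmf (pmf_of_set A) (pmf_of_set B) = pmf_of_set (A \<times> B)"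
proof (rule pmf_eqI)
  fix z
  show "pmf (pair_pmf (pmf_of_set A) (pmf_of_set B)) z = pmf (pmf_of_set (A \<times> B)) z"
    using assms by (cases z) (simp add: pmf_pair indicator_times card_cartesian_product)
qed

theorem mainTheorem2:
  shows "(\<forall>s \<in> carrier S. s \<in> Units S \<longleftrightarrow> odd (weight s)) \<and>
    (\<forall>\<delta> \<in> challenges. \<forall>\<delta>' \<in> challenges.
      challenge_diff \<delta> \<delta>' \<in> Units S \<longleftrightarrow> odd (hamming_distance \<delta> \<delta>')) \<and>
    real (card {(\<delta>, \<delta>'). \<delta> \<in> challenges \<and> \<delta>' \<in> challenges \<and> \<delta> \<noteq> \<delta>' \<and>
                  challenge_diff \<delta> \<delta>' \<notin> Units S}) /
      real (card {(\<delta>, \<delta>'). \<delta> \<in> challenges \<and> \<delta>' \<in> challenges \<and> \<delta> \<noteq> \<delta>'})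
      = (2 ^ 255 - 1) / (2 ^ 256 - 1) \<and>
    ((2 ^ 255 - 1) / (2 ^ 256 - 1) :: real) = 1 / 2 - 1 / (2 ^ 257 - 2) \<and>
    measure_pmf.prob (pair_pmf (pmf_of_set challenges) (pmf_of_set challenges))
      {(\<delta>, \<delta>'). challenge_diff \<delta> \<delta>' \<notin> Units S} = 1 / 2"
proof (intro conjI ballI)
  fix s assume "s \<in> carrier S"
  then show "s \<in> Units S \<longleftrightarrow> odd (weight s)" by (rule Units_iff_odd_weight)
next
  fix \<delta> \<delta>' assume "\<delta> \<in> challenges" "\<delta>' \<in> challenges"
  then show "challenge_diff \<delta> \<delta>' \<in> Units S \<longleftrightarrow> odd (hamming_distance \<delta> \<delta>')"
    by (rule challenge_diff_Units_iff_hamming)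
next
  have nonunit: "card {(\<delta>, \<delta>'). \<delta> \<in> challenges \<and> \<delta>' \<in> challenges \<and> \<delta> \<noteq> \<delta>' \<and>
      challenge_diff \<delta> \<delta>' \<notin> Units S} = 2 ^ 511 - 2 ^ 256"
    unfolding card_nonunit_pairs[symmetric] card_challenges[symmetric]
    \<comment> \<open>On the diagonal the difference of values is 0, hence even, so
      \<open>challenge_diff\<close> is a nonunit there.\<close>
    by (intro card_distinct_pairs finite_challenges) (simp add: challenge_diff_Units_iff_parity)
  have "{(\<delta>, \<delta>'). \<delta> \<in> challenges \<and> \<delta>' \<in> challenges} = challenges \<times> challenges" by auto
  then have all: "card {(\<delta>, \<delta>'). \<delta> \<in> challenges \<and> \<delta>' \<in> challenges \<and> \<delta> \<noteq> \<delta>'} = 2 ^ 512 - 2 ^ 256"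
    using card_distinct_pairs[OF finite_challenges, of "\<lambda>_ _. True"]
    by (simp add: card_cartesian_product card_challenges)
  show "real (card {(\<delta>, \<delta>'). \<delta> \<in> challenges \<and> \<delta>' \<in> challenges \<and> \<delta> \<noteq> \<delta>' \<and>
                  challenge_diff \<delta> \<delta>' \<notin> Units S}) /
      real (card {(\<delta>, \<delta>'). \<delta> \<in> challenges \<and> \<delta>' \<in> challenges \<and> \<delta> \<noteq> \<delta>'})
      = (2 ^ 255 - 1) / (2 ^ 256 - 1)"
    \<comment> \<open>The common factor 2^256 of 2^511 - 2^256 and 2^512 - 2^256 cancels.\<close>
    unfolding nonunit all by simp
next
  show "((2 ^ 255 - 1) / (2 ^ 256 - 1) :: real) = 1 / 2 - 1 / (2 ^ 257 - 2)" by simp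
next
  have nonempty: "challenges \<noteq> {}" using card_challenges by auto
  \<comment> \<open>The event also contains pairs outside the support; intersecting with the support
    leaves the counted set, and 2^511 / 2^512 = 1/2.\<close>
  have "challenges \<times> challenges \<inter> {(\<delta>, \<delta>'). challenge_diff \<delta> \<delta>' \<notin> Units S} =
      {(\<delta>, \<delta>'). \<delta> \<in> challenges \<and> \<delta>' \<in> challenges \<and> challenge_diff \<delta> \<delta>' \<notin> Units S}" by auto
  then show "measure_pmf.prob (pair_pmf (pmf_of_set challenges) (pmf_of_set challenges))
      {(\<delta>, \<delta>'). challenge_diff \<delta> \<delta>' \<notin> Units S} = 1 / 2"
    using nonempty finite_challenges
    by (simp add: pair_pmf_of_set measure_pmf_of_set card_nonunit_pairs
        card_cartesian_product card_challenges)
qed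

end
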